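(* Let $1<p\le q<\infty$, let $q'$ be defined by $1/q+1/q'=1$, and let $\mu$ be a positive Borel measure on $[0,1)$ which is a $1$-Carleson measure. (i) For any $\gamma>0$: if $\mu$ is a $(1/p+1/q'+1+\gamma)$-Carleson measure, then $\mathcal{DH}_\mu$ is a bounded operator from $H^p$ into $H^q$. (ii) If $\mathcal{DH}_\mu$ is a bounded operator from $H^p$ into $H^q$, then $\mu$ is a $(1/p+1/q'+1)$-Carleson measure.
   Context: $\mathbb{D}$ is the open unit disc in $\mathbb{C}$. For $0<p<\infty$, the Hardy space $H^p$ consists of all analytic $f$ on $\mathbb{D}$ with $\|f\|_{H^p}=\sup_{0<r<1}\left(\frac1{2\pi}\int_0^{2\pi}|f(re^{i\theta})|^p\,d\theta\right)^{1/p}<\infty$. For a positive Borel measure $\mu$ on $[0,1)$, let $\mu_n=\int_{[0,1)}t^n\,d\mu(t)$, and for $f(z)=\sum_{k=0}^\infty a_kz^k$ analytic on $\mathbb{D}$ put $$\mathcal{DH}_\mu(f)(z)=\sum_{n=0}^\infty (n+1)\Big(\sum_{k=0}^\infty \mu_{n+k}a_k\Big)z^n .$$ When $1<p<\infty$ and $\mu$ is a $1$-Carleson measure, this is a well-defined analytic function on $\mathbb{D}$ for every $f\in H^p$. For $s>0$, a positive Borel measure $\mu$ on $[0,1)$ is an $s$-Carleson measure if there is a constant $C>0$ with $\mu([t,1))\le C(1-t)^s$ for all $0\le t<1$. *)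

theory Defs
  imports "HOL-Complex_Analysis.Complex_Analysis"
begin

text \<open>
  Functions on the unit disc are represented by total functions of type
  \<open>complex \<Rightarrow> complex\<close>; only their values on \<open>ball 0 1\<close> matter.  The Hardy norm takes values in
  \<open>ennreal\<close>, so that the supremum over the radii may be infinite.
\<close>

definition hardy_norm :: "real \<Rightarrow> (complex \<Rightarrow> complex) \<Rightarrow> ennreal" where
  "hardy_norm p f =
     (SUP r\<in>{0<..<1::real}.
        ennreal ((1 / (2 * pi) *
          integral {0..2 * pi} (\<lambda>\<theta>. norm (f (of_real r * cis \<theta>)) powr p)) powr (1 / p)))"

definition hardy_space :: "real \<Rightarrow> (complex \<Rightarrow> complex) set" where
  "hardy_space p = {f. f holomorphic_on ball 0 1 \<and> hardy_norm p f < \<infinity>}"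

definition hardy_bounded_operator ::
    "real \<Rightarrow> real \<Rightarrow> ((complex \<Rightarrow> complex) \<Rightarrow> (complex \<Rightarrow> complex)) \<Rightarrow> bool" where
  "hardy_bounded_operator p q T \<longleftrightarrow>
     (\<forall>f\<in>hardy_space p. T f \<in> hardy_space q) \<and>
     (\<forall>f\<in>hardy_space p. \<forall>g\<in>hardy_space p. \<forall>a b. \<forall>z\<in>ball 0 1.
        T (\<lambda>w. a * f w + b * g w) z = a * T f z + b * T g z) \<and>
     (\<exists>C::real. C \<ge> 0 \<and>
        (\<forall>f\<in>hardy_space p. hardy_norm q (T f) \<le> ennreal C * hardy_norm p f))"

definition borel_measure_on_unit_interval :: "real measure \<Rightarrow> bool" where
  "borel_measure_on_unit_interval \<mu> \<longleftrightarrow> sets \<mu> = sets (restrict_space borel {0..<1})"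

definition carleson_measure :: "real \<Rightarrow> real measure \<Rightarrow> bool" where
  "carleson_measure s \<mu> \<longleftrightarrow>
     (\<exists>C::real. C > 0 \<and> (\<forall>t\<in>{0..<1}. emeasure \<mu> {t..<1} \<le> ennreal (C * (1 - t) powr s)))"

definition moment :: "real measure \<Rightarrow> nat \<Rightarrow> real" where
  "moment \<mu> n = (\<integral>t. t ^ n \<partial>\<mu>)"

text \<open>
  The coefficients \<open>a\<^sub>k\<close> of \<open>f(z) = \<Sum>\<^sub>k a\<^sub>k z\<^sup>k\<close> are those of \<open>fps_expansion f 0\<close>.  Both series below
  converge whenever \<open>f\<close> lies in the Hardy space with exponent \<open>p > 1\<close> and \<open>\<mu>\<close> is a 1-Carleson
  measure, for \<open>norm z < 1\<close>.
\<close>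

definition derivative_hilbert ::
    "real measure \<Rightarrow> (complex \<Rightarrow> complex) \<Rightarrow> complex \<Rightarrow> complex" where
  "derivative_hilbert \<mu> f z =
     (\<Sum>n. of_nat (n + 1) *
        (\<Sum>k. of_real (moment \<mu> (n + k)) * fps_nth (fps_expansion f 0) k) * z ^ n)"

end

theory Submission
  imports Defs
begin

text \<open>
  For \<open>f\<close> in \<open>H\<^sup>p\<close>, summing the series gives \<open>DH f(z) = \<integral> f(t) / (1 - t z)\<^sup>2 d\<mu>(t)\<close>, and Cauchy's formula
  with Hoelder's inequality gives the sharp growth \<open>f(t) = O((1 - t)\<^bsup>-1/p\<^esup>)\<close>.

  (i) Both \<open>1 - t\<close> and \<open>|1 - z| / 2\<close> are lower bounds for \<open>|1 - t z|\<close>. Splitting the exponent 2 as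
  \<open>(2 - \<alpha>) + \<alpha>\<close> with \<open>\<alpha>\<close> slightly below \<open>1/q\<close> bounds \<open>|DH f(z)|\<close> by \<open>|1 - z|\<^bsup>-\<alpha>\<^esup>\<close> times
  \<open>\<integral> (1 - t)\<^bsup>-1/p - 2 + \<alpha>\<^esup> d\<mu>(t)\<close>. The slack \<open>\<gamma>\<close> makes this integral finite, and \<open>\<alpha> q < 1\<close> makes
  \<open>|1 - z|\<^bsup>-\<alpha> q\<^esup>\<close> uniformly integrable over circles.

  (ii) For \<open>f(z) = 1 / (1 - a z)\<close>, whose norm is of order \<open>(1 - a)\<^bsup>1/p - 1\<^esup>\<close>, positivity gives
  \<open>DH f(a) \<ge> \<mu>([a, 1)) / (1 - a\<^sup>2)\<^sup>3\<close>. Comparing this with the growth bound for \<open>DH f\<close> in \<open>H\<^sup>q\<close> yields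
  the Carleson condition.
\<close>

subsection \<open>Circle integrals of the kernel\<close>

text \<open>Taylor's bound gives sin x >= x - x^3 / 6, and x < 2 makes x^3 at most 4 x. Only the
  linear order in \<open>x\<close> matters below.\<close>

lemma sin_ge_third:
  fixes x :: real
  assumes "0 \<le> x" "x \<le> pi / 2"
  shows "x / 3 \<le> sin x"
proof -
  have x2: "x < 2" using assms pi_half_less_two by simp
  have "\<bar>sin x - (\<Sum>m<3. sin_coeff m * x ^ m)\<bar> \<le> inverse (fact 3) * \<bar>x\<bar> ^ 3"
    by (rule Maclaurin_sin_bound)
  then have "x - x ^ 3 / 6 \<le> sin x"
    using assms unfolding abs_le_iff by (simp add: eval_nat_numeral sin_coeff_def)
  moreover have "x ^ 3 \<le> 4 * x"
  proof -
    have "x * x \<le> 2 * 2" using assms x2 by (intro mult_mono) auto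
    then have "x * x * x \<le> 4 * x" using assms by (intro mult_right_mono) auto
    then show ?thesis by (simp add: power3_eq_cube)
  qed
  ultimately show ?thesis by simp
qed

text \<open>The second bound is the reverse triangle inequality; the first then follows from 1 - z =
  (1 - t z) - (1 - t) z. One lower bound depends on \<open>z\<close> alone, the other on
  \<open>t\<close> alone, which later allows the variables to be separated.\<close>

lemma norm_one_minus_le_twice:
  fixes z :: complex and t :: real
  assumes "norm z \<le> 1" "0 \<le> t" "t \<le> 1"
  shows "norm (1 - z) \<le> 2 * norm (1 - of_real t * z)"
    and "1 - t \<le> norm (1 - of_real t * z)"
proof -
  have "1 - norm (of_real t * z) \<le> norm (1 - of_real t * z)"
    by (metis norm_one norm_triangle_ineq2)
  moreover have "t * norm z \<le> t * 1" using assms by (intro mult_left_mono) auto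
  ultimately show *: "1 - t \<le> norm (1 - of_real t * z)"
    using assms by (simp add: norm_mult)
  have "1 - z = (1 - of_real t * z) - of_real (1 - t) * z" by (simp add: algebra_simps)
  then have "norm (1 - z) \<le> norm (1 - of_real t * z) + (1 - t) * norm z"
    by (metis abs_of_nonneg assms(3) diff_ge_0_iff_ge norm_mult norm_of_real norm_triangle_ineq4)
  moreover have "(1 - t) * norm z \<le> (1 - t) * 1" using assms by (intro mult_left_mono) auto
  ultimately show "norm (1 - z) \<le> 2 * norm (1 - of_real t * z)"
    using * by simp
qed

lemma norm_one_minus_cis: "norm (1 - cis x) = 2 * \<bar>sin (x / 2)\<bar>"
proof -
  have "(norm (1 - cis x))\<^sup>2 = 2 - 2 * cos x"
    using sin_cos_squared_add3[of x]
    unfolding cmod_power2 by (simp add: power2_eq_square algebra_simps)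
  also have "cos x = 1 - 2 * (sin (x / 2))\<^sup>2"
    using cos_double_sin[of "x / 2"] by simp
  finally have "(norm (1 - cis x))\<^sup>2 = (2 * \<bar>sin (x / 2)\<bar>)\<^sup>2"
    by (simp add: power_mult_distrib)
  then show ?thesis
    by (rule power2_eq_imp_eq) auto
qed

text \<open>Both ends of the parameter interval are the point 1 of the circle, and the two
  alternatives measure the distance to the nearer end. The sine estimate bounds that distance by six
  times the norm, and 1 - r is at most the norm; the resulting factor 7 is relaxed to 12.\<close>

lemma norm_one_minus_cis_ge:
  assumes "0 \<le> r" "r < 1" "0 \<le> x" "x \<le> 2 * pi"
  shows "(1 - r + x) / 12 \<le> norm (1 - of_real r * cis x) \<or>
         (1 - r + (2 * pi - x)) / 12 \<le> norm (1 - of_real r * cis x)"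
proof -
  let ?N = "norm (1 - of_real r * cis x)"
  have 1: "2 * \<bar>sin (x / 2)\<bar> \<le> 2 * ?N" "1 - r \<le> ?N"
    using norm_one_minus_le_twice[of "cis x" r] assms by (auto simp: norm_one_minus_cis)
  show ?thesis
  proof (cases "x \<le> pi")
    case True
    then have "x / 2 / 3 \<le> sin (x / 2)" using assms by (intro sin_ge_third) auto
    then show ?thesis using 1 assms by (auto simp: field_simps)
  next
    case False
    then have "(pi - x / 2) / 3 \<le> sin (pi - x / 2)" using assms by (intro sin_ge_third) auto
    also have "sin (pi - x / 2) = sin (x / 2)" by (rule sin_pi_minus)
    finally have "(pi - x / 2) / 3 \<le> ?N" using 1 by linarith
    then have "(1 - r + (2 * pi - x)) / 12 \<le> ?N" using 1 assms by (auto simp: field_simps)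
    then show ?thesis by simp
  qed
qed

lemma circle_kernel_continuous:
  assumes "norm w < 1"
  shows "continuous_on S (\<lambda>x. norm (1 - w * cis x) powr b)"
proof -
  have "1 - w * cis x \<noteq> 0" for x
  proof
    assume "1 - w * cis x = 0"
    then have "norm (w * cis x) = 1" by simp
    with assms show False by (simp add: norm_mult)
  qed
  then show ?thesis
    by (intro continuous_intros) auto
qed

text \<open>The sum of the majorants attached to the two ends dominates the kernel whichever
  alternative holds, and both have the same explicit integral. The formula covers a < 1 and a > 1
  together; the two cases are simplified separately below.\<close>

lemma circle_kernel_integral_le:
  assumes a: "0 < a" "a \<noteq> 1" and r: "0 \<le> r" "r < 1"
  shows "integral {0..2 * pi} (\<lambda>x. norm (1 - of_real r * cis x) powr (- a)) \<le>
         2 * 12 powr a * (((1 - r + 2 * pi) powr (1 - a) - (1 - r) powr (1 - a)) / (1 - a))"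
proof -
  define d where "d = 1 - r"
  have d: "d > 0" using r by (simp add: d_def)
  define J where "J = ((d + 2 * pi) powr (1 - a) - d powr (1 - a)) / (1 - a)"
  let ?k = "\<lambda>x. norm (1 - of_real r * cis x) powr (- a)"
  have 1: "((\<lambda>x. (d + x) powr (- a)) has_integral J) {0..2 * pi}"
  proof -
    have "((\<lambda>x. (d + x) powr (- a)) has_integral
        (d + 2 * pi) powr (1 - a) / (1 - a) - (d + 0) powr (1 - a) / (1 - a)) {0..2 * pi}"
      by (intro fundamental_theorem_of_calculus)
         (use d a in \<open>auto intro!: derivative_eq_intros
           simp flip: has_real_derivative_iff_has_vector_derivative\<close>)
    then show ?thesis by (simp add: J_def diff_divide_distrib)
  qed
  have 2: "((\<lambda>x. (d + (2 * pi - x)) powr (- a)) has_integral J) {0..2 * pi}"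
  proof -
    have "((\<lambda>x. (d + (2 * pi - x)) powr (- a)) has_integral
        - ((d + (2 * pi - 2 * pi)) powr (1 - a) / (1 - a)) -
        - ((d + (2 * pi - 0)) powr (1 - a) / (1 - a))) {0..2 * pi}"
      by (intro fundamental_theorem_of_calculus)
         (use d a in \<open>auto intro!: derivative_eq_intros
           simp flip: has_real_derivative_iff_has_vector_derivative\<close>)
    then show ?thesis by (simp add: J_def diff_divide_distrib)
  qed
  have 3: "((\<lambda>x. 12 powr a * ((d + x) powr (- a) + (d + (2 * pi - x)) powr (- a)))
      has_integral 12 powr a * (J + J)) {0..2 * pi}"
    by (intro has_integral_mult_right has_integral_add 1 2)
  have "integral {0..2 * pi} ?k \<le> 12 powr a * (J + J)"
  proof (rule has_integral_le[OF _ 3])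
    show "(?k has_integral integral {0..2 * pi} ?k) {0..2 * pi}"
      using r by (intro integrable_integral integrable_continuous_interval circle_kernel_continuous)
        auto
  next
    fix x assume "x \<in> {0..2 * pi}"
    then have x: "0 \<le> x" "x \<le> 2 * pi" by auto
    have *: "?k x \<le> 12 powr a * y powr (- a)"
      if "y / 12 \<le> norm (1 - of_real r * cis x)" "y > 0" for y
    proof -
      have "?k x \<le> (y / 12) powr (- a)"
        using that a by (intro powr_mono2') auto
      also have "\<dots> = 12 powr a * y powr (- a)"
        using that by (simp add: powr_divide powr_minus field_simps)
      finally show ?thesis .
    qed
    have nn: "0 \<le> 12 powr a * (d + x) powr (- a)" "0 \<le> 12 powr a * (d + (2 * pi - x)) powr (- a)"
      by auto
    have "?k x \<le> 12 powr a * (d + x) powr (- a) \<or>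
          ?k x \<le> 12 powr a * (d + (2 * pi - x)) powr (- a)"
      using norm_one_minus_cis_ge[OF r x] *[of "d + x"] *[of "d + (2 * pi - x)"] d x
      by (auto simp: d_def)
    then show "?k x \<le> 12 powr a * ((d + x) powr (- a) + (d + (2 * pi - x)) powr (- a))"
      using nn unfolding distrib_left by linarith
  qed
  also have "12 powr a * (J + J) = 2 * 12 powr a * J" by simp
  finally show ?thesis unfolding J_def d_def .
qed

text \<open>For a > 1 the boundary term at 1 - r + 2 pi enters with a negative sign and is dropped;
  the one at 1 - r carries the blow-up.\<close>

lemma circle_kernel_integral_le_supercritical:
  assumes a: "1 < a" and r: "0 \<le> r" "r < 1"
  shows "integral {0..2 * pi} (\<lambda>x. norm (1 - of_real r * cis x) powr (- a)) \<le>
         2 * 12 powr a / (a - 1) * (1 - r) powr (1 - a)"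
proof -
  have "((1 - r + 2 * pi) powr (1 - a) - (1 - r) powr (1 - a)) / (1 - a)
      = (1 - r) powr (1 - a) / (a - 1) - (1 - r + 2 * pi) powr (1 - a) / (a - 1)"
    using a by (simp add: divide_simps) (simp add: algebra_simps)
  also have "\<dots> \<le> (1 - r) powr (1 - a) / (a - 1)"
    using a by simp
  finally have "2 * 12 powr a * (((1 - r + 2 * pi) powr (1 - a) - (1 - r) powr (1 - a)) / (1 - a))
     \<le> 2 * 12 powr a * ((1 - r) powr (1 - a) / (a - 1))"
    by (intro mult_left_mono) auto
  then show ?thesis
    using circle_kernel_integral_le[of a r] assms by simp
qed

lemma circle_kernel_integral_le_subcritical:
  assumes a: "0 < a" "a < 1" and r: "0 \<le> r" "r < 1"
  shows "integral {0..2 * pi} (\<lambda>x. norm (1 - of_real r * cis x) powr (- a)) \<le>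
         2 * 12 powr a * (1 + 2 * pi) powr (1 - a) / (1 - a)"
proof -
  have "(1 - r + 2 * pi) powr (1 - a) - (1 - r) powr (1 - a) \<le> (1 + 2 * pi) powr (1 - a)"
    using powr_mono2[of "1 - a" "1 - r + 2 * pi" "1 + 2 * pi"] a r
    by (smt (verit) powr_ge_zero pi_gt_zero)
  then have "2 * 12 powr a * (((1 - r + 2 * pi) powr (1 - a) - (1 - r) powr (1 - a)) / (1 - a))
     \<le> 2 * 12 powr a * ((1 + 2 * pi) powr (1 - a) / (1 - a))"
    using a by (intro mult_left_mono divide_right_mono) auto
  then show ?thesis
    using circle_kernel_integral_le[of a r] assms by simp
qed

section \<open>Hoelder's inequality on an interval\<close>

lemma integral_nonneg_total:
  fixes f :: "real \<Rightarrow> real"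
  assumes "\<And>x. x \<in> S \<Longrightarrow> 0 \<le> f x"
  shows "0 \<le> integral S f"
  \<comment> \<open>A function that is not integrable has integral 0 by convention.\<close>
  by (metis assms integral_nonneg not_integrable_integral order_refl)

text \<open>Young's inequality for f / A and g / B is integrated. Positive upper bounds
  \<open>A\<close> and \<open>B\<close> take the place of the norms themselves, which avoids
  division by a vanishing norm.\<close>

lemma Holder_inequality_interval:
  fixes f g :: "real \<Rightarrow> real"
  assumes pq: "p > 1" "q > 1" "1 / p + 1 / q = 1"
    and f: "continuous_on {a..b} f" "\<And>x. x \<in> {a..b} \<Longrightarrow> 0 \<le> f x"
    and g: "continuous_on {a..b} g" "\<And>x. x \<in> {a..b} \<Longrightarrow> 0 \<le> g x"
    and A: "A > 0" "integral {a..b} (\<lambda>x. f x powr p) \<le> A powr p"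
    and B: "B > 0" "integral {a..b} (\<lambda>x. g x powr q) \<le> B powr q"
  shows "integral {a..b} (\<lambda>x. f x * g x) \<le> A * B"
proof -
  have int: "(\<lambda>x. f x powr p) integrable_on {a..b}" "(\<lambda>x. g x powr q) integrable_on {a..b}"
    "(\<lambda>x. f x * g x) integrable_on {a..b}"
    using assms by (auto intro!: integrable_continuous_interval continuous_intros continuous_on_powr')
  have young: "f x * g x \<le> A * B * (f x powr p / (p * A powr p) + g x powr q / (q * B powr q))"
    if "x \<in> {a..b}" for x
  proof -
    have "f x / A * (g x / B) \<le> (f x / A) powr p / p + (g x / B) powr q / q"
      using pq f(2)[OF that] g(2)[OF that] A B by (intro Youngs_inequality) auto
    then have "f x * g x / (A * B) \<le> f x powr p / (p * A powr p) + g x powr q / (q * B powr q)"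
      using f(2)[OF that] g(2)[OF that] A B by (simp add: powr_divide mult.commute)
    then show ?thesis
      using A(1) B(1) by (simp add: pos_divide_le_eq mult.commute)
  qed
  have "integral {a..b} (\<lambda>x. f x * g x) \<le>
      integral {a..b} (\<lambda>x. A * B * (f x powr p / (p * A powr p) + g x powr q / (q * B powr q)))"
    by (intro integral_le young integrable_on_mult_right integrable_add integrable_on_divide int)
  also have "\<dots> = A * B * (integral {a..b} (\<lambda>x. f x powr p) / (p * A powr p) +
                          integral {a..b} (\<lambda>x. g x powr q) / (q * B powr q))"
    by (simp add: integral_add integrable_on_divide int)
  also have "\<dots> \<le> A * B * (A powr p / (p * A powr p) + B powr q / (q * B powr q))"
    using A B pq by (intro mult_left_mono add_mono divide_right_mono) auto
  also have "\<dots> = A * B * (1 / p + 1 / q)"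
    using A B by simp
  finally show ?thesis using pq by simp
qed

section \<open>Circle means, the Hardy norm and Cauchy's formula on circles\<close>

lemma circle_in_disc:
  assumes "0 < r" "r < 1"
  shows "of_real r * cis x \<in> ball 0 (1::real)"
  using assms by (simp add: norm_mult)

lemma continuous_on_circle:
  fixes f :: "complex \<Rightarrow> complex"
  assumes "f holomorphic_on ball 0 1" "0 < r" "r < 1"
  shows "continuous_on S (\<lambda>x. f (of_real r * cis x))"
  using assms circle_in_disc[OF assms(2,3)]
  by (intro continuous_on_compose2[OF holomorphic_on_imp_continuous_on[OF assms(1)]]
      continuous_intros) auto

text \<open>This lemma and its converse \<open>hardy_norm_leI\<close> trade the extended-real
  supremum for real integral bounds on every single circle; all later norm estimates pass through
  them.\<close>

lemma hardy_norm_le_imp_integral_le: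
  assumes "p > 0" "A \<ge> 0" "hardy_norm p f \<le> ennreal A" "0 < r" "r < 1"
  shows "integral {0..2 * pi} (\<lambda>x. norm (f (of_real r * cis x)) powr p) \<le> 2 * pi * A powr p"
proof -
  let ?I = "integral {0..2 * pi} (\<lambda>x. norm (f (of_real r * cis x)) powr p)"
  have I: "?I \<ge> 0" by (rule integral_nonneg_total) auto
  have "ennreal ((1 / (2 * pi) * ?I) powr (1 / p)) \<le> hardy_norm p f"
    unfolding hardy_norm_def using assms by (intro SUP_upper) auto
  also note assms(3)
  finally have "(1 / (2 * pi) * ?I) powr (1 / p) \<le> A"
    using assms by simp
  then have "((1 / (2 * pi) * ?I) powr (1 / p)) powr p \<le> A powr p"
    using assms by (intro powr_mono2) auto
  then have "1 / (2 * pi) * ?I \<le> A powr p"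
    using I assms by (simp add: powr_powr)
  then show ?thesis by (simp add: field_simps)
qed

lemma hardy_norm_leI:
  assumes "p > 0" "A \<ge> 0"
    and "\<And>r. 0 < r \<Longrightarrow> r < 1 \<Longrightarrow>
      integral {0..2 * pi} (\<lambda>x. norm (f (of_real r * cis x)) powr p) \<le> 2 * pi * A powr p"
  shows "hardy_norm p f \<le> ennreal A"
  unfolding hardy_norm_def
proof (rule SUP_least)
  fix r :: real assume "r \<in> {0<..<1}"
  let ?I = "integral {0..2 * pi} (\<lambda>x. norm (f (of_real r * cis x)) powr p)"
  have "1 / (2 * pi) * ?I \<le> A powr p"
    using assms(3)[of r] \<open>r \<in> {0<..<1}\<close> by (simp add: field_simps)
  moreover have "?I \<ge> 0" by (rule integral_nonneg_total) auto
  ultimately have "(1 / (2 * pi) * ?I) powr (1 / p) \<le> (A powr p) powr (1 / p)"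
    using assms(1) by (intro powr_mono2) auto
  then show "ennreal ((1 / (2 * pi) * ?I) powr (1 / p)) \<le> ennreal A"
    using assms by (simp add: powr_powr ennreal_leI)
qed

lemma Cauchy_integral_circle:
  fixes f :: "complex \<Rightarrow> complex"
  assumes f: "f holomorphic_on ball 0 1" and r: "0 < r" "r < 1" and w: "norm w < r"
  shows "((\<lambda>x. f (of_real r * cis x) * (of_real r * cis x) / (of_real r * cis x - w))
           has_integral (2 * pi * f w)) {0..2 * pi}"
proof -
  have "f holomorphic_on cball 0 r"
    using r by (intro holomorphic_on_subset[OF f]) auto
  then have "((\<lambda>u. f u / (u - w)) has_contour_integral (2 * of_real pi * \<i> * f w)) (circlepath 0 r)"
    using w by (intro Cauchy_integral_circlepath_simple) auto
  then have "((\<lambda>x. f (of_real r * cis x) / (of_real r * cis x - w) * r * \<i> * cis x)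
      has_integral (2 * of_real pi * \<i> * f w)) {0..2 * pi}"
    by (simp add: circlepath_def has_contour_integral_part_circlepath_iff)
  \<comment> \<open>The parametrisation of the circle contributes a factor i to the integrand, and
    Cauchy's formula one to the value; multiplying by -i clears both.\<close>
  from has_integral_mult_right[OF this, of "- \<i>"] show ?thesis
    by (simp add: field_simps)
qed

lemma fps_expansion_nth_integral_circle:
  fixes f :: "complex \<Rightarrow> complex"
  assumes f: "f holomorphic_on ball 0 1" and r: "0 < r" "r < 1"
  shows "((\<lambda>x. f (of_real r * cis x) / (of_real r * cis x) ^ k)
           has_integral (2 * pi * fps_nth (fps_expansion f 0) k)) {0..2 * pi}"
proof -
  have "f holomorphic_on cball 0 r"
    using r by (intro holomorphic_on_subset[OF f]) auto
  then have "((\<lambda>u. f u / (u - 0) ^ Suc k) has_contour_integral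
      (2 * pi * \<i> / fact k * (deriv ^^ k) f 0)) (circlepath 0 r)"
    using r by (intro Cauchy_has_contour_integral_higher_derivative_circlepath)
      (auto intro: holomorphic_on_imp_continuous_on holomorphic_on_subset)
  then have "((\<lambda>x. f (of_real r * cis x) / (of_real r * cis x) ^ Suc k * r * \<i> * cis x)
      has_integral (2 * pi * \<i> / fact k * (deriv ^^ k) f 0)) {0..2 * pi}"
    by (simp add: circlepath_def has_contour_integral_part_circlepath_iff)
  from has_integral_mult_right[OF this, of "- \<i>"] show ?thesis
    using r by (simp add: field_simps fps_expansion_def)
qed

subsection \<open>Growth and coefficients of Hardy space functions\<close>

text \<open>The crude inequality y <= 1 + y^p controls the mean of |f| by that of |f|^p. Boundedness
  in \<open>k\<close> is all that matters: it justifies the later interchanges of sum and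
  integral.\<close>

lemma fps_expansion_nth_le_hardy_norm:
  assumes f: "f holomorphic_on ball 0 1" and p: "1 \<le> p"
    and A: "0 \<le> A" "hardy_norm p f \<le> ennreal A"
  shows "norm (fps_nth (fps_expansion f 0) k) \<le> 1 + A powr p"
proof -
  let ?a = "norm (fps_nth (fps_expansion f 0) k)"
  have bound: "r ^ k * ?a \<le> 1 + A powr p" if r: "0 < r" "r < 1" for r
  proof -
    have cont: "continuous_on {0..2 * pi} (\<lambda>x. f (of_real r * cis x))"
      using f r by (rule continuous_on_circle)
    have int: "(\<lambda>x. norm (f (of_real r * cis x)) powr p) integrable_on {0..2 * pi}"
      using p by (intro integrable_continuous_interval continuous_on_powr' continuous_intros cont) auto
    note * = fps_expansion_nth_integral_circle[OF f r, of k]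
    have le: "norm (f (of_real r * cis x) / (of_real r * cis x) ^ k) \<le>
        (1 + norm (f (of_real r * cis x)) powr p) / r ^ k" for x
    proof -
      have "y \<le> 1 + y powr p" if "0 \<le> y" for y :: real
      proof (cases "y \<le> 1")
        case False
        then have "y powr 1 \<le> y powr p" using p by (intro powr_mono) auto
        then show ?thesis using False by simp
      qed (smt (verit) powr_ge_zero)
      from this[of "norm (f (of_real r * cis x))"] show ?thesis
        using r by (simp add: norm_divide norm_mult norm_power divide_right_mono)
    qed
    have "norm (2 * pi * fps_nth (fps_expansion f 0) k) \<le>
        integral {0..2 * pi} (\<lambda>x. (1 + norm (f (of_real r * cis x)) powr p) / r ^ k)"
      unfolding integral_unique[OF *, symmetric]
      by (intro integral_norm_bound_integral le has_integral_integrable[OF *] integrable_on_divide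
          integrable_add integrable_const_ivl int)
    also have "\<dots> = (2 * pi + integral {0..2 * pi} (\<lambda>x. norm (f (of_real r * cis x)) powr p)) / r ^ k"
      by (simp add: integral_add int integrable_const_ivl)
    also have "\<dots> \<le> (2 * pi + 2 * pi * A powr p) / r ^ k"
      using hardy_norm_le_imp_integral_le[of p A f r] p A r by (intro divide_right_mono) auto
    finally have "2 * pi * ?a \<le> 2 * pi * ((1 + A powr p) / r ^ k)"
      by (simp add: norm_mult algebra_simps)
    then have "?a \<le> (1 + A powr p) / r ^ k"
      unfolding mult_le_cancel_left_pos[OF pi_gt_zero[THEN mult_pos_pos[OF zero_less_numeral]]] .
    then show ?thesis using r by (simp add: field_simps)
  qed
  \<comment> \<open>The factor \<open>r ^ k\<close> disappears in the limit as \<open>r\<close>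
    tends to 1, because the right-hand side is independent of \<open>r\<close>.\<close>
  have "((\<lambda>r. r ^ k * ?a) \<longlongrightarrow> 1 ^ k * ?a) (at_left 1)"
    by (intro tendsto_intros)
  moreover have "\<forall>\<^sub>F r in at_left 1. r ^ k * ?a \<le> 1 + A powr p"
    by (rule eventually_mono[OF eventually_at_left_real[of 0 1]]) (auto intro: bound)
  ultimately have "1 ^ k * ?a \<le> 1 + A powr p"
    by (rule tendsto_upperbound) simp
  then show ?thesis by simp
qed

text \<open>Hoelder's inequality in Cauchy's formula pairs the p-mean of \<open>f\<close> with the
  q-mean of the Cauchy kernel, \<open>q\<close> being the conjugate exponent. The kernel contributes
  the exponent (1 - q) / q = -1/p. The constant is chosen before \<open>f\<close>, so it depends on
  \<open>p\<close> only.\<close>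

lemma hardy_growth:
  fixes p :: real
  assumes p: "1 < p"
  obtains C where "0 < C"
    "\<And>f A t. f holomorphic_on ball 0 1 \<Longrightarrow> 0 < A \<Longrightarrow> hardy_norm p f \<le> ennreal A \<Longrightarrow>
      0 \<le> t \<Longrightarrow> t < 1 \<Longrightarrow> norm (f (of_real t)) \<le> C * A * (1 - t) powr (- (1 / p))"
proof -
  define q where "q = p / (p - 1)"
  have q: "1 < q" "1 / p + 1 / q = 1"
    using p by (auto simp: q_def field_simps)
  define c where "c = 2 * 12 powr q / (q - 1)"
  have c: "c > 0" using q by (simp add: c_def)
  define C where "C = (2 * pi) powr (1 / p) * c powr (1 / q) * 2 powr (1 / p) / (2 * pi)"
  show ?thesis
  proof (rule that[of C])
    show "0 < C" using c by (simp add: C_def)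
    fix f :: "complex \<Rightarrow> complex" and A t :: real
    assume f: "f holomorphic_on ball 0 1" and A: "0 < A" "hardy_norm p f \<le> ennreal A"
      and t: "0 \<le> t" "t < 1"
    \<comment> \<open>With the midpoint of \<open>t\<close> and 1 as radius, the ratio
      \<open>u\<close> = t / r satisfies 1 - u >= (1 - t) / 2, so the kernel integral for
      \<open>u\<close> has the right order in 1 - t.\<close>
    define r where "r = (1 + t) / 2"
    define u where "u = t / r"
    have r: "0 < r" "r < 1" "t < r" using t by (auto simp: r_def)
    have u: "0 \<le> u" "u < 1" using r t by (auto simp: u_def)
    have "(1 - t) / 2 \<le> (1 - t) / (1 + t)"
      using t by (intro divide_left_mono) auto
    also have "\<dots> = 1 - u" using t by (simp add: u_def r_def field_simps)
    finally have u': "(1 - t) / 2 \<le> 1 - u" .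
    let ?g = "\<lambda>x. norm (1 - of_real u * cis x) powr (- 1)"
    \<comment> \<open>Chosen so that \<open>B powr q\<close> is exactly the bound for the kernel
      integral.\<close>
    define B where "B = (c * ((1 - t) / 2) powr (1 - q)) powr (1 / q)"
    \<comment> \<open>As |cis x| = 1, conjugation turns the Cauchy kernel into the kernel estimated
      above.\<close>
    have norm_eq: "norm (f (of_real r * cis x) * (of_real r * cis x) / (of_real r * cis x - of_real t))
        = norm (f (of_real r * cis x)) * ?g x" for x
    proof -
      have "cis x * cis (- x) = 1" by (simp add: cis_mult)
      then have "of_real r * cis x - of_real t = of_real r * cis x * cnj (1 - of_real u * cis x)"
        using r by (simp add: u_def algebra_simps cis_cnj)
      then have "norm (of_real r * cis x - of_real t) = r * norm (1 - of_real u * cis x)"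
        using r by (simp only: norm_mult complex_mod_cnj norm_cis norm_of_real)
      then show ?thesis using r
        by (simp add: norm_mult norm_divide powr_minus_divide)
    qed
    have cont: "continuous_on {0..2 * pi} (\<lambda>x. f (of_real r * cis x))"
      using f r by (intro continuous_on_circle)
    have contg: "continuous_on {0..2 * pi} ?g"
      using u by (intro circle_kernel_continuous) auto
    have "norm (2 * pi * f (of_real t)) \<le> integral {0..2 * pi} (\<lambda>x. norm (f (of_real r * cis x)) * ?g x)"
    proof -
      have *: "((\<lambda>x. f (of_real r * cis x) * (of_real r * cis x) / (of_real r * cis x - of_real t))
          has_integral (2 * pi * f (of_real t))) {0..2 * pi}"
        using t r by (intro Cauchy_integral_circle f) auto
      show ?thesis
        unfolding integral_unique[OF *, symmetric]
        by (intro integral_norm_bound_integral has_integral_integrable[OF *]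
            integrable_continuous_interval continuous_intros cont contg)
           (simp only: norm_eq)
    qed
    also have "\<dots> \<le> ((2 * pi) powr (1 / p) * A) * B"
    proof (rule Holder_inequality_interval[OF p q])
      show "integral {0..2 * pi} (\<lambda>x. norm (f (of_real r * cis x)) powr p) \<le> ((2 * pi) powr (1 / p) * A) powr p"
        using hardy_norm_le_imp_integral_le[of p A f r] p A r by (simp add: powr_mult powr_powr)
      have "integral {0..2 * pi} (\<lambda>x. norm (1 - of_real u * cis x) powr (- q)) \<le> c * (1 - u) powr (1 - q)"
        unfolding c_def by (intro circle_kernel_integral_le_supercritical q u)
      also have "\<dots> \<le> c * ((1 - t) / 2) powr (1 - q)"
        using c q u' t by (intro mult_left_mono powr_mono2') auto
      also have "\<dots> = B powr q"
        using c q t by (simp add: B_def powr_powr)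
      finally show "integral {0..2 * pi} (\<lambda>x. ?g x powr q) \<le> B powr q"
        by (simp only: powr_powr mult_minus1)
      show "0 < B" using c t by (simp add: B_def)
    qed (use A cont contg in \<open>auto intro!: continuous_intros\<close>)
    also have "B = c powr (1 / q) * (2 powr (1 / p) * (1 - t) powr (- (1 / p)))"
    proof -
      have "(1 - q) * (1 / q) = - (1 / p)" using q by (simp add: field_simps)
      then have "B = c powr (1 / q) * ((1 - t) / 2) powr (- (1 / p))"
        using c t by (simp add: B_def powr_mult powr_powr)
      then show ?thesis using t by (simp add: powr_divide powr_minus field_simps)
    qed
    finally show "norm (f (of_real t)) \<le> C * A * (1 - t) powr (- (1 / p))"
      by (simp add: norm_mult C_def field_simps)
  qed
qed

section \<open>The test functions 1 / (1 - a z)\<close>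

lemma hardy_norm_kernel_le:
  fixes p :: real
  assumes p: "1 < p"
  obtains C where "0 < C"
    "\<And>a. 0 \<le> a \<Longrightarrow> a < 1 \<Longrightarrow>
      hardy_norm p (\<lambda>z. 1 / (1 - of_real a * z)) \<le> ennreal (C * (1 - a) powr (1 / p - 1))"
proof -
  define c where "c = 2 * 12 powr p / (p - 1)"
  have c: "c > 0" using p by (simp add: c_def)
  show ?thesis
  proof (rule that[of "(c / (2 * pi)) powr (1 / p)"])
    show "0 < (c / (2 * pi)) powr (1 / p)" using c by simp
    fix a :: real assume a: "0 \<le> a" "a < 1"
    show "hardy_norm p (\<lambda>z. 1 / (1 - of_real a * z)) \<le>
        ennreal ((c / (2 * pi)) powr (1 / p) * (1 - a) powr (1 / p - 1))"
    proof (rule hardy_norm_leI)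
      fix r :: real assume r: "0 < r" "r < 1"
      \<comment> \<open>On the circle of radius \<open>r\<close> the test function is the kernel
        with parameter a r; since a r <= a, the estimate at \<open>a\<close> serves all
        radii.\<close>
      have ar: "0 \<le> a * r" "a * r < 1" "a * r \<le> a"
        using a r mult_left_mono[of r 1 a] by auto
      have "integral {0..2 * pi} (\<lambda>x. norm (1 / (1 - of_real a * (of_real r * cis x))) powr p)
          = integral {0..2 * pi} (\<lambda>x. norm (1 - of_real (a * r) * cis x) powr (- p))"
        by (intro integral_cong)
           (simp add: norm_divide powr_divide powr_minus_divide mult.assoc)
      also have "\<dots> \<le> c * (1 - a * r) powr (1 - p)"
        unfolding c_def by (intro circle_kernel_integral_le_supercritical p ar)
      also have "\<dots> \<le> c * (1 - a) powr (1 - p)"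
        using c a ar p by (intro mult_left_mono powr_mono2') auto
      also have "\<dots> = 2 * pi * ((c / (2 * pi)) powr (1 / p) * (1 - a) powr (1 / p - 1)) powr p"
        using p c by (simp add: powr_mult powr_powr algebra_simps)
      finally show "integral {0..2 * pi} (\<lambda>x. norm (1 / (1 - of_real a * (of_real r * cis x))) powr p)
         \<le> \<dots>" .
    qed (use p in auto)
  qed
qed

lemma kernel_nonzero:
  assumes "norm z < 1" "0 \<le> a" "a \<le> 1"
  shows "1 - of_real a * z \<noteq> (0 :: complex)"
proof
  assume "1 - of_real a * z = 0"
  then have "norm (of_real a * z) = 1" by simp
  moreover have "norm (of_real a * z) \<le> 1 * norm z"
    using assms unfolding norm_mult by (intro mult_right_mono) auto
  ultimately show False using assms by simp
qed

lemma kernel_holomorphic: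
  assumes "0 \<le> a" "a \<le> 1"
  shows "(\<lambda>z. 1 / (1 - of_real a * z)) holomorphic_on ball 0 1"
  using assms kernel_nonzero[of _ a] by (intro holomorphic_intros) auto

lemma fps_expansion_kernel:
  assumes "0 \<le> a" "a \<le> 1"
  shows "fps_nth (fps_expansion (\<lambda>z. 1 / (1 - of_real a * z)) 0) k = of_real a ^ k"
proof -
  have "(\<lambda>n. (of_real a * z) ^ n) sums (1 / (1 - of_real a * z))" if "z \<in> ball 0 1" for z :: complex
    using assms that mult_right_mono[of a 1 "norm z"] by (intro geometric_sums) (auto simp: norm_mult)
  then have "\<forall>\<^sub>F z in nhds (0 :: complex).
      (\<lambda>n. fps_nth (Abs_fps (\<lambda>n. of_real a ^ n)) n * z ^ n) sums (1 / (1 - of_real a * z))"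
    using eventually_nhds_in_open[of "ball 0 1" "0 :: complex"]
    by (auto elim!: eventually_mono simp: power_mult_distrib)
  then have "(\<lambda>z :: complex. 1 / (1 - of_real a * z)) has_fps_expansion Abs_fps (\<lambda>n. of_real a ^ n)"
    by (rule has_fps_expansionI)
  then show ?thesis
    by (simp add: fps_expansion_eqI)
qed

subsection \<open>Carleson measures and the integral representation\<close>

lemma space_unit_interval:
  assumes "borel_measure_on_unit_interval \<mu>"
  shows "space \<mu> = {0..<1}"
  using sets_eq_imp_space_eq[of \<mu> "restrict_space borel {0..<1}"] assms
  by (simp add: borel_measure_on_unit_interval_def space_restrict_space)

lemma sets_unit_interval:
  assumes "borel_measure_on_unit_interval \<mu>" "0 \<le> t"
  shows "{t..<1} \<in> sets \<mu>"
proof -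
  have "{t..<1} = {t..<1} \<inter> {0..<1}" using assms(2) by auto
  then show ?thesis
    using assms(1) by (auto simp: borel_measure_on_unit_interval_def sets_restrict_space)
qed

lemma measurable_continuous_unit_interval:
  fixes f :: "real \<Rightarrow> 'a :: topological_space"
  assumes "borel_measure_on_unit_interval \<mu>" "continuous_on {0..<1} f"
  shows "f \<in> borel_measurable \<mu>"
  using borel_measurable_continuous_on_restrict[OF assms(2)] assms(1)
  by (simp add: borel_measure_on_unit_interval_def cong: measurable_cong_sets)

lemma carleson_measure_finite:
  assumes "borel_measure_on_unit_interval \<mu>" "carleson_measure s \<mu>"
  shows "finite_measure \<mu>"
proof
  from assms(2) obtain C where "\<forall>t\<in>{0..<1}. emeasure \<mu> {t..<1} \<le> ennreal (C * (1 - t) powr s)"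
    by (auto simp: carleson_measure_def)
  from this[rule_format, of 0] show "emeasure \<mu> (space \<mu>) \<noteq> \<infinity>"
    by (auto simp: space_unit_interval[OF assms(1)] top_unique)
qed

text \<open>Layer-cake estimate over the dyadic sets where \<open>1 - t \<le> 2\<^sup>-\<^sup>j\<close>.\<close>

lemma integrable_carleson_powr:
  assumes \<mu>: "borel_measure_on_unit_interval \<mu>" "carleson_measure s \<mu>"
    and b: "0 \<le> b" "b < s"
  shows "integrable \<mu> (\<lambda>t. (1 - t) powr (- b))"
proof (rule integrableI_bounded)
  show "(\<lambda>t. (1 - t) powr (- b)) \<in> borel_measurable \<mu>"
    by (intro measurable_continuous_unit_interval \<mu> continuous_intros) auto
  from \<mu>(2) obtain C where C: "C > 0"
    "\<And>t. t \<in> {0..<1} \<Longrightarrow> emeasure \<mu> {t..<1} \<le> ennreal (C * (1 - t) powr s)"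
    by (auto simp: carleson_measure_def)
  \<comment> \<open>A point with 2^-(j+1) < 1 - t <= 2^-j lies in \<open>E j\<close>, and there the
    integrand is at most \<open>c j\<close>. Hence a single term of the series already dominates
    it.\<close>
  define c where "c j = ((1/2) ^ Suc j) powr (- b)" for j :: nat
  define E where "E j = {1 - (1/2) ^ j..<1::real}" for j :: nat
  have E_sets: "E j \<in> sets \<mu>" for j
    unfolding E_def by (intro sets_unit_interval \<mu>) (simp add: power_le_one)
  have le: "ennreal (norm ((1 - t) powr (- b))) \<le> (\<Sum>j. ennreal (c j) * indicator (E j) t)"
    if t: "t \<in> space \<mu>" for t
  proof -
    from t have t: "0 \<le> t" "t < 1" by (auto simp: space_unit_interval[OF \<mu>(1)])
    \<comment> \<open>The first index with 2^-k < 1 - t is positive because 1 - t <= 1; its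
      predecessor \<open>j\<close> names the dyadic shell of \<open>t\<close>.\<close>
    define k where "k = (LEAST k. (1/2) ^ k < 1 - t)"
    have "\<exists>k. (1/2) ^ k < 1 - t" using t by (intro real_arch_pow_inv) auto
    then have k: "(1/2) ^ k < 1 - t" unfolding k_def by (rule LeastI_ex)
    then have "k \<noteq> 0" using t by (intro notI) auto
    then obtain j where j: "k = Suc j" by (cases k) auto
    have "\<not> (1/2) ^ j < 1 - t"
      using not_less_Least[of j "\<lambda>k. (1/2) ^ k < 1 - t"] j by (simp add: k_def)
    then have "t \<in> E j" using t by (simp add: E_def)
    have "(1 - t) powr (- b) \<le> c j"
      unfolding c_def using k j b by (intro powr_mono2') auto
    then have "ennreal (norm ((1 - t) powr (- b))) \<le> (\<Sum>j\<in>{j}. ennreal (c j) * indicator (E j) t)"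
      using \<open>t \<in> E j\<close> by (simp add: ennreal_leI)
    also have "\<dots> \<le> (\<Sum>j. ennreal (c j) * indicator (E j) t)"
      by (intro sum_le_suminf) auto
    finally show ?thesis .
  qed
  \<comment> \<open>\<open>c j\<close> grows like 2^(b j), while the Carleson condition makes the
    mass of \<open>E j\<close> decay like 2^(-s j); b < s leaves a convergent geometric
    series.\<close>
  have term_le: "ennreal (c j) * emeasure \<mu> (E j) \<le> ennreal (C * 2 powr b * (2 powr (b - s)) ^ j)" for j
  proof -
    have "ennreal (c j) * emeasure \<mu> (E j) \<le> ennreal (c j) * ennreal (C * (1 - (1 - (1/2) ^ j)) powr s)"
      unfolding E_def by (intro mult_left_mono C) (auto simp: power_le_one)
    also have "\<dots> = ennreal (c j * (C * ((1/2) ^ j) powr s))"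
      by (simp add: ennreal_mult' c_def)
    also have "c j * (C * ((1/2) ^ j) powr s) = C * 2 powr b * (2 powr (b - s)) ^ j"
    proof -
      have half: "(1/2::real) ^ i = 2 powr (- real i)" for i
        by (simp add: powr_minus powr_realpow power_divide field_simps)
      have "(2 powr (b - s)) ^ j = 2 powr ((b - s) * real j)"
        by (simp add: powr_powr flip: powr_realpow)
      then show ?thesis
        unfolding c_def half by (simp add: powr_powr algebra_simps flip: powr_add)
    qed
    finally show ?thesis .
  qed
  have summ: "summable (\<lambda>j. C * 2 powr b * (2 powr (b - s)) ^ j)"
    using powr_less_mono[of "b - s" 0 2] b by (intro summable_mult summable_geometric) auto
  have "(\<integral>\<^sup>+ t. ennreal (norm ((1 - t) powr (- b))) \<partial>\<mu>) \<le>
      (\<integral>\<^sup>+ t. (\<Sum>j. ennreal (c j) * indicator (E j) t) \<partial>\<mu>)"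
    by (intro nn_integral_mono le)
  also have "\<dots> = (\<Sum>j. \<integral>\<^sup>+ t. ennreal (c j) * indicator (E j) t \<partial>\<mu>)"
    using E_sets by (intro nn_integral_suminf) auto
  also have "\<dots> = (\<Sum>j. ennreal (c j) * emeasure \<mu> (E j))"
    using E_sets by (simp add: nn_integral_cmult_indicator)
  also have "\<dots> \<le> (\<Sum>j. ennreal (C * 2 powr b * (2 powr (b - s)) ^ j))"
    by (intro suminf_le term_le) auto
  also have "\<dots> = ennreal (\<Sum>j. C * 2 powr b * (2 powr (b - s)) ^ j)"
    using C summ by (intro suminf_ennreal2) auto
  also have "\<dots> < \<infinity>" by simp
  finally show "(\<integral>\<^sup>+ t. ennreal (norm ((1 - t) powr (- b))) \<partial>\<mu>) < \<infinity>" .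
qed

section \<open>Interchange of the series with the integral\<close>

lemma fps_expansion_sums_unit_disc:
  assumes "f holomorphic_on ball 0 1" "norm z < 1"
  shows "(\<lambda>k. fps_nth (fps_expansion f 0) k * z ^ k) sums f z"
  using holomorphic_power_series[OF assms(1), of z] assms(2)
  by (simp add: fps_expansion_def)

text \<open>Comparison with the geometric series. It explains why integrability of 1 / (1 - t) is
  the hypothesis on \<mu> in the following two lemmas.\<close>

lemma norm_le_bounded_coefficients:
  assumes f: "f holomorphic_on ball 0 1" and M: "\<And>k. norm (fps_nth (fps_expansion f 0) k) \<le> M"
    and t: "0 \<le> t" "t < 1"
  shows "norm (f (of_real t)) \<le> M / (1 - t)"
proof -
  have 1: "(\<lambda>k. M * t ^ k) sums (M * (1 / (1 - t)))"
    using t by (intro sums_mult geometric_sums) auto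
  have 2: "(\<lambda>k. fps_nth (fps_expansion f 0) k * of_real t ^ k) sums f (of_real t)"
    using t by (intro fps_expansion_sums_unit_disc f) auto
  have le: "norm (fps_nth (fps_expansion f 0) k * of_real t ^ k) \<le> M * t ^ k" for k
    using M[of k] t by (simp add: norm_mult norm_power mult_right_mono)
  have "norm (f (of_real t)) = norm (\<Sum>k. fps_nth (fps_expansion f 0) k * of_real t ^ k)"
    using 2 by (simp add: sums_iff)
  also have "\<dots> \<le> (\<Sum>k. M * t ^ k)"
    by (intro norm_suminf_le le) (use 1 in \<open>auto simp: sums_iff\<close>)
  also have "\<dots> = M / (1 - t)" using 1 by (simp add: sums_iff)
  finally show ?thesis .
qed

text \<open>The inner sum over \<open>k\<close> is moved under the integral: the partial sums of the
  absolute values stay below M / (1 - t), which is integrable.\<close>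

lemma
  assumes \<mu>: "borel_measure_on_unit_interval \<mu>" "integrable \<mu> (\<lambda>t. 1 / (1 - t))"
    and f: "f holomorphic_on ball 0 1" and M: "\<And>k. norm (fps_nth (fps_expansion f 0) k) \<le> M"
  shows integrable_power_mult: "integrable \<mu> (\<lambda>t. of_real (t ^ n) * f (of_real t))"
    and moment_sums_integral:
      "(\<lambda>k. of_real (moment \<mu> (n + k)) * fps_nth (fps_expansion f 0) k) sums
         (\<integral>t. of_real (t ^ n) * f (of_real t) \<partial>\<mu>)"
proof -
  have space: "space \<mu> = {0..<1}" by (rule space_unit_interval[OF \<mu>(1)])
  define F where "F k t = (of_real (t ^ (n + k)) * fps_nth (fps_expansion f 0) k :: complex)" for k t
  have M0: "0 \<le> M" using M[of 0] norm_ge_zero order_trans by blast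
  have F_le: "norm (F k t) \<le> M * t ^ k" if "t \<in> space \<mu>" for k t
  proof -
    have "norm (F k t) \<le> t ^ (n + k) * M"
      using that M[of k] by (auto simp: F_def norm_mult norm_power space intro!: mult_left_mono)
    also have "\<dots> \<le> t ^ k * M"
      using that M0 by (intro mult_right_mono power_decreasing) (auto simp: space)
    finally show ?thesis by (simp add: mult.commute)
  qed
  have meas: "F k \<in> borel_measurable \<mu>" for k
    unfolding F_def by (intro measurable_continuous_unit_interval \<mu> continuous_intros)
  have intM: "integrable \<mu> (\<lambda>t. M * (1 / (1 - t)))"
    by (intro integrable_mult_right \<mu>)
  have part_le: "(\<Sum>k<N. norm (F k t)) \<le> M * (1 / (1 - t))" if t: "t \<in> space \<mu>" for N t
  proof -
    have "(\<Sum>k<N. norm (F k t)) \<le> M * (\<Sum>k<N. t ^ k)"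
      unfolding sum_distrib_left by (intro sum_mono F_le t)
    also have "(\<Sum>k<N. t ^ k) \<le> (\<Sum>k. t ^ k)"
      using t by (intro sum_le_suminf summable_geometric) (auto simp: space)
    also have "\<dots> = 1 / (1 - t)" using t by (intro suminf_geometric) (auto simp: space)
    finally show ?thesis using M0 by (simp add: mult_left_mono)
  qed
  have int: "integrable \<mu> (F k)" for k
  proof (rule Bochner_Integration.integrable_bound[OF intM meas])
    show "AE t in \<mu>. norm (F k t) \<le> norm (M * (1 / (1 - t)))"
    proof (rule AE_I2)
      fix t assume t: "t \<in> space \<mu>"
      have "norm (F k t) \<le> (\<Sum>k<Suc k. norm (F k t))" by (simp add: sum_nonneg)
      also have "\<dots> \<le> M * (1 / (1 - t))" by (rule part_le[OF t])
      also have "\<dots> \<le> norm (M * (1 / (1 - t)))" by (simp only: real_norm_def abs_ge_self)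
      finally show "norm (F k t) \<le> norm (M * (1 / (1 - t)))" .
    qed
  qed
  have 1: "AE t in \<mu>. summable (\<lambda>k. norm (F k t))"
    by (rule AE_I2, rule summableI_nonneg_bounded) (auto intro: part_le)
  have 2: "summable (\<lambda>k. \<integral>t. norm (F k t) \<partial>\<mu>)"
  proof (rule summableI_nonneg_bounded)
    fix N
    have "(\<Sum>k<N. \<integral>t. norm (F k t) \<partial>\<mu>) = (\<integral>t. (\<Sum>k<N. norm (F k t)) \<partial>\<mu>)"
      by (rule Bochner_Integration.integral_sum[symmetric]) (auto intro: integrable_norm int)
    also have "\<dots> \<le> (\<integral>t. M * (1 / (1 - t)) \<partial>\<mu>)"
      by (intro integral_mono part_le intM Bochner_Integration.integrable_sum integrable_norm int)
    finally show "(\<Sum>k<N. \<integral>t. norm (F k t) \<partial>\<mu>) \<le> \<dots>" .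
  qed (auto intro: integral_nonneg_AE)
  have eq: "(\<Sum>k. F k t) = of_real (t ^ n) * f (of_real t)" if t: "t \<in> space \<mu>" for t
  proof -
    have "(\<lambda>k. of_real (t ^ n) * (fps_nth (fps_expansion f 0) k * of_real t ^ k)) sums
        (of_real (t ^ n) * f (of_real t))"
      using t by (intro sums_mult fps_expansion_sums_unit_disc f) (auto simp: space)
    then show ?thesis by (simp add: F_def sums_iff power_add mult_ac)
  qed
  show "integrable \<mu> (\<lambda>t. of_real (t ^ n) * f (of_real t))"
    using integrable_suminf[OF int 1 2] eq by (simp cong: Bochner_Integration.integrable_cong)
  have "(\<integral>t. F k t \<partial>\<mu>) = of_real (moment \<mu> (n + k)) * fps_nth (fps_expansion f 0) k" for k
    by (simp add: F_def moment_def del: of_real_power)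
  then show "(\<lambda>k. of_real (moment \<mu> (n + k)) * fps_nth (fps_expansion f 0) k) sums
         (\<integral>t. of_real (t ^ n) * f (of_real t) \<partial>\<mu>)"
    using sums_integral[OF int 1 2] eq by (simp cong: Bochner_Integration.integral_cong)
qed

text \<open>The outer sum over \<open>n\<close> is moved under the integral with the majorant (n +
  1) |z|^n M / (1 - t), and the differentiated geometric series sums to 1 / (1 - t z)^2. Besides the
  value of the operator, convergence of its power series is recorded, since holomorphy rests on
  it.\<close>

lemma
  assumes \<mu>: "borel_measure_on_unit_interval \<mu>" "integrable \<mu> (\<lambda>t. 1 / (1 - t))"
    and f: "f holomorphic_on ball 0 1" and M: "\<And>k. norm (fps_nth (fps_expansion f 0) k) \<le> M"
    and z: "norm z < 1"
  shows integrable_derivative_hilbert: "integrable \<mu> (\<lambda>t. f (of_real t) / (1 - of_real t * z)\<^sup>2)"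
    and derivative_hilbert_sums:
      "(\<lambda>n. of_nat (n + 1) * (\<Sum>k. of_real (moment \<mu> (n + k)) * fps_nth (fps_expansion f 0) k) * z ^ n)
         sums (\<integral>t. f (of_real t) / (1 - of_real t * z)\<^sup>2 \<partial>\<mu>)"
    and derivative_hilbert_eq_integral:
      "derivative_hilbert \<mu> f z = (\<integral>t. f (of_real t) / (1 - of_real t * z)\<^sup>2 \<partial>\<mu>)"
proof -
  have space: "space \<mu> = {0..<1}" by (rule space_unit_interval[OF \<mu>(1)])
  define G where "G n t = of_nat (n + 1) * (of_real (t ^ n) * f (of_real t)) * z ^ n" for n t
  have int: "integrable \<mu> (G n)" for n
    unfolding G_def by (intro integrable_mult_left integrable_mult_right integrable_power_mult[OF \<mu> f M])
  have G_eq: "(\<integral>t. G n t \<partial>\<mu>) =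
      of_nat (n + 1) * (\<Sum>k. of_real (moment \<mu> (n + k)) * fps_nth (fps_expansion f 0) k) * z ^ n" for n
    using moment_sums_integral[OF \<mu> f M, of n] by (simp add: G_def sums_iff)
  have intM: "integrable \<mu> (\<lambda>t. M * (1 / (1 - t)))"
    by (intro integrable_mult_right \<mu>)
  have norm_G: "norm (G n t) \<le> real (n + 1) * norm z ^ n * (M * (1 / (1 - t)))"
    if t: "t \<in> space \<mu>" for n t
  proof -
    have "norm (G n t) = real (n + 1) * norm z ^ n * (t ^ n * norm (f (of_real t)))"
      using t by (simp add: G_def norm_mult norm_power space del: of_nat_add of_nat_Suc)
    also have "t ^ n * norm (f (of_real t)) \<le> 1 * (M / (1 - t))"
      using t norm_le_bounded_coefficients[OF f M, of t]
      by (intro mult_mono) (auto simp: space power_le_one)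
    finally show ?thesis by (simp add: mult_left_mono)
  qed
  have summ: "summable (\<lambda>n. real (n + 1) * norm z ^ n)"
    using geometric_deriv_sums[of "norm z"] z by (auto simp: sums_iff)
  have 1: "AE t in \<mu>. summable (\<lambda>n. norm (G n t))"
  proof (rule AE_I2)
    fix t assume t: "t \<in> space \<mu>"
    have "norm (norm (G n t)) \<le> real (n + 1) * norm z ^ n * (M * (1 / (1 - t)))" for n
      unfolding real_norm_def abs_norm_cancel by (rule norm_G[OF t])
    then show "summable (\<lambda>n. norm (G n t))"
      by (rule summable_comparison_test'[OF summable_mult2[OF summ]])
  qed
  have 2: "summable (\<lambda>n. \<integral>t. norm (G n t) \<partial>\<mu>)"
  proof (rule summable_comparison_test'[OF summable_mult2[OF summ]])
    fix n
    have "(\<integral>t. norm (G n t) \<partial>\<mu>) \<le> (\<integral>t. real (n + 1) * norm z ^ n * (M * (1 / (1 - t))) \<partial>\<mu>)"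
      by (intro integral_mono integrable_norm int norm_G integrable_mult_right[OF intM])
    also have "\<dots> = real (n + 1) * norm z ^ n * (\<integral>t. M * (1 / (1 - t)) \<partial>\<mu>)"
      by (rule integral_mult_right_zero)
    finally show "norm (\<integral>t. norm (G n t) \<partial>\<mu>) \<le>
        real (n + 1) * norm z ^ n * (\<integral>t. M * (1 / (1 - t)) \<partial>\<mu>)"
      by simp
  qed
  have eq: "(\<Sum>n. G n t) = f (of_real t) / (1 - of_real t * z)\<^sup>2" if t: "t \<in> space \<mu>" for t
  proof -
    have "norm (of_real t * z) < 1"
      using t z mult_right_mono[of t 1 "norm z"] by (auto simp: norm_mult space)
    from sums_mult[OF geometric_deriv_sums[OF this], of "f (of_real t)"] show ?thesis
      by (simp add: G_def sums_iff power_mult_distrib mult_ac)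
  qed
  show "integrable \<mu> (\<lambda>t. f (of_real t) / (1 - of_real t * z)\<^sup>2)"
    using integrable_suminf[OF int 1 2] eq by (simp cong: Bochner_Integration.integrable_cong)
  show sums: "(\<lambda>n. of_nat (n + 1) * (\<Sum>k. of_real (moment \<mu> (n + k)) * fps_nth (fps_expansion f 0) k) * z ^ n)
         sums (\<integral>t. f (of_real t) / (1 - of_real t * z)\<^sup>2 \<partial>\<mu>)"
    using sums_integral[OF int 1 2] eq unfolding G_eq by (simp cong: Bochner_Integration.integral_cong)
  show "derivative_hilbert \<mu> f z = (\<integral>t. f (of_real t) / (1 - of_real t * z)\<^sup>2 \<partial>\<mu>)"
    unfolding derivative_hilbert_def using sums by (simp add: sums_iff)
qed

subsection \<open>Necessity of the Carleson condition\<close>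

lemma moment_nonneg:
  assumes "borel_measure_on_unit_interval \<mu>"
  shows "0 \<le> moment \<mu> n"
  unfolding moment_def
  by (intro integral_nonneg_AE AE_I2) (auto simp: space_unit_interval[OF assms])

lemma integrable_power_unit_interval:
  assumes "borel_measure_on_unit_interval \<mu>" "finite_measure \<mu>"
  shows "integrable \<mu> (\<lambda>t. t ^ n)"
  using assms
  by (intro finite_measure.integrable_const_bound[where B = 1] AE_I2
      measurable_continuous_unit_interval continuous_intros)
     (auto simp: space_unit_interval power_le_one)

lemma moment_le:
  assumes "borel_measure_on_unit_interval \<mu>" "finite_measure \<mu>"
  shows "moment \<mu> n \<le> measure \<mu> (space \<mu>)"
proof -
  have "moment \<mu> n \<le> (\<integral>t. 1 \<partial>\<mu>)"
    unfolding moment_def using assms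
    by (intro integral_mono integrable_power_unit_interval)
       (auto simp: space_unit_interval power_le_one finite_measure.integrable_const)
  then show ?thesis by simp
qed

text \<open>On [a, 1) the integrand t^n is at least a^n, and elsewhere it is nonnegative.\<close>

lemma moment_ge:
  assumes \<mu>: "borel_measure_on_unit_interval \<mu>" "finite_measure \<mu>" and a: "0 \<le> a"
  shows "a ^ n * measure \<mu> {a..<1} \<le> moment \<mu> n"
proof -
  interpret finite_measure \<mu> by fact
  have sets: "{a..<1} \<in> sets \<mu>" using \<mu>(1) a by (rule sets_unit_interval)
  have "a ^ n * measure \<mu> {a..<1} = (\<integral>t. a ^ n * indicator {a..<1} t \<partial>\<mu>)"
    using sets by (simp add: sets.sets_into_space Int_absorb2)
  also have "\<dots> \<le> moment \<mu> n"
    unfolding moment_def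
  proof (rule integral_mono)
    show "integrable \<mu> (\<lambda>t. a ^ n * indicator {a..<1} t)"
      using sets by (auto simp: less_top[symmetric])
    show "a ^ n * indicator {a..<1} t \<le> t ^ n" if "t \<in> space \<mu>" for t
      using that a by (auto simp: space_unit_interval[OF \<mu>(1)] power_mono split: split_indicator)
  qed (rule integrable_power_unit_interval[OF \<mu>])
  finally show ?thesis .
qed

text \<open>All Taylor coefficients of the test function are nonnegative, so each moment may be replaced
  by its contribution from \<open>[a, 1)\<close>.\<close>

lemma derivative_hilbert_kernel_ge:
  assumes \<mu>: "borel_measure_on_unit_interval \<mu>" "finite_measure \<mu>" and a: "0 \<le> a" "a < 1"
  shows "measure \<mu> {a..<1} / (1 - a\<^sup>2) ^ 3 \<le>
    norm (derivative_hilbert \<mu> (\<lambda>z. 1 / (1 - of_real a * z)) (of_real a))"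
proof -
  define m where "m = measure \<mu> {a..<1}"
  have m: "m \<ge> 0" by (simp add: m_def)
  have a2: "a\<^sup>2 < 1" using a by (simp add: power_less_one_iff)
  \<comment> \<open>The inner series of the operator at the test function, whose Taylor coefficients
    are a^k.\<close>
  define c where "c n = (\<Sum>k. moment \<mu> (n + k) * a ^ k)" for n
  have summ: "summable (\<lambda>k. moment \<mu> (n + k) * a ^ k)" for n
  proof (rule summable_comparison_test'[OF summable_mult[OF summable_geometric[of a]]])
    show "norm a < 1" using a by simp
    show "norm (moment \<mu> (n + k) * a ^ k) \<le> measure \<mu> (space \<mu>) * a ^ k" for k
      using a moment_le[OF \<mu>] moment_nonneg[OF \<mu>(1)] by (simp add: abs_mult mult_right_mono)
  qed
  have c_le: "c n \<le> measure \<mu> (space \<mu>) * (1 / (1 - a))" for n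
  proof -
    have "c n \<le> (\<Sum>k. measure \<mu> (space \<mu>) * a ^ k)"
      unfolding c_def using a moment_le[OF \<mu>]
      by (intro suminf_le summ mult_right_mono summable_mult summable_geometric) auto
    also have "\<dots> = measure \<mu> (space \<mu>) * (1 / (1 - a))"
      using a by (subst suminf_mult) (auto simp: suminf_geometric summable_geometric)
    finally show ?thesis .
  qed
  \<comment> \<open>The moment contributes a^(n+k) and the coefficient a^k, so the sum over
    \<open>k\<close> is geometric with ratio a^2 and yields the first factor 1 / (1 - a^2).\<close>
  have c_ge: "a ^ n * m / (1 - a\<^sup>2) \<le> c n" for n
  proof -
    have "(\<lambda>k. a ^ n * m * (a\<^sup>2) ^ k) sums (a ^ n * m * (1 / (1 - a\<^sup>2)))"
      using a2 by (intro sums_mult geometric_sums) auto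
    moreover have "a ^ n * m * (a\<^sup>2) ^ k \<le> moment \<mu> (n + k) * a ^ k" for k
    proof -
      have "a ^ (n + k) * m * a ^ k \<le> moment \<mu> (n + k) * a ^ k"
        using moment_ge[OF \<mu> a(1), of "n + k"] a by (intro mult_right_mono) (auto simp: m_def)
      then show ?thesis by (simp add: power_add power2_eq_square power_mult_distrib mult_ac)
    qed
    moreover have "(\<lambda>k. moment \<mu> (n + k) * a ^ k) sums c n"
      unfolding c_def by (rule summable_sums[OF summ])
    ultimately have "a ^ n * m * (1 / (1 - a\<^sup>2)) \<le> c n"
      by (intro sums_le[of _ _ "a ^ n * m * (1 / (1 - a\<^sup>2))" "c n"])
    then show ?thesis by simp
  qed
  have c_nonneg: "0 \<le> c n" for n
    unfolding c_def by (intro suminf_nonneg summ mult_nonneg_nonneg moment_nonneg \<mu>) (use a in auto)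
  have summ': "summable (\<lambda>n. real (n + 1) * c n * a ^ n)"
  proof (rule summable_comparison_test')
    show "summable (\<lambda>n. real (n + 1) * a ^ n * (measure \<mu> (space \<mu>) * (1 / (1 - a))))"
      using geometric_deriv_sums[of a] a by (intro summable_mult2) (auto simp: sums_iff)
    fix n
    have "real (n + 1) * a ^ n * c n \<le> real (n + 1) * a ^ n * (measure \<mu> (space \<mu>) * (1 / (1 - a)))"
      using a by (intro mult_left_mono c_le) auto
    then show "norm (real (n + 1) * c n * a ^ n) \<le> real (n + 1) * a ^ n * (measure \<mu> (space \<mu>) * (1 / (1 - a)))"
      using a c_nonneg[of n] by (simp add: abs_mult mult_ac)
  qed
  \<comment> \<open>Here a^n comes once from the bound on \<open>c n\<close> and once from
    evaluation at the point \<open>a\<close>. The weights n + 1 then give 1 / (1 - a^2)^2, so the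
    cube is complete.\<close>
  have "(\<lambda>n. m / (1 - a\<^sup>2) * (real (Suc n) * (a\<^sup>2) ^ n)) sums (m / (1 - a\<^sup>2) * (1 / (1 - a\<^sup>2)\<^sup>2))"
    using a2 by (intro sums_mult geometric_deriv_sums) auto
  moreover have "m / (1 - a\<^sup>2) * (real (Suc n) * (a\<^sup>2) ^ n) \<le> real (n + 1) * c n * a ^ n" for n
  proof -
    have "real (n + 1) * (a ^ n * m / (1 - a\<^sup>2)) * a ^ n \<le> real (n + 1) * c n * a ^ n"
      using a by (intro mult_right_mono mult_left_mono c_ge) auto
    then show ?thesis by (simp add: power2_eq_square power_mult_distrib mult_ac)
  qed
  ultimately have "m / (1 - a\<^sup>2) * (1 / (1 - a\<^sup>2)\<^sup>2) \<le> (\<Sum>n. real (n + 1) * c n * a ^ n)"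
    using summ' by (metis (no_types, lifting) sums_iff suminf_le)
  also have "m / (1 - a\<^sup>2) * (1 / (1 - a\<^sup>2)\<^sup>2) = m / (1 - a\<^sup>2) ^ 3"
    by (simp add: power3_eq_cube power2_eq_square)
  also have "(\<Sum>n. real (n + 1) * c n * a ^ n) \<le>
      norm (derivative_hilbert \<mu> (\<lambda>z. 1 / (1 - of_real a * z)) (of_real a))"
  proof -
    have "(\<Sum>k. of_real (moment \<mu> (n + k)) * of_real a ^ k) = (of_real (c n) :: complex)" for n
      unfolding c_def using suminf_of_real[OF summ[of n], where 'a = complex] by simp
    then have "derivative_hilbert \<mu> (\<lambda>z. 1 / (1 - of_real a * z)) (of_real a) =
        (\<Sum>n. of_real (real (n + 1) * c n * a ^ n))"
      unfolding derivative_hilbert_def using a by (simp add: fps_expansion_kernel)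
    also have "\<dots> = of_real (\<Sum>n. real (n + 1) * c n * a ^ n)"
      by (rule suminf_of_real[OF summ', symmetric])
    finally show ?thesis by (simp only: norm_of_real abs_ge_self)
  qed
  finally show ?thesis by (simp add: m_def)
qed

text \<open>The exponents add up: 1/p - 1 from the norm of the test function, -1/q from the growth
  in \<open>H^q\<close>, and 3 from the cube of 1 - a^2.\<close>

lemma hardy_bounded_imp_carleson:
  assumes p: "1 < p" and q: "1 < q"
    and \<mu>: "borel_measure_on_unit_interval \<mu>" "finite_measure \<mu>"
    and bdd: "hardy_bounded_operator p q (derivative_hilbert \<mu>)"
  shows "carleson_measure (1 / p + 2 - 1 / q) \<mu>"
proof -
  interpret finite_measure \<mu> by fact
  obtain C1 where C1: "0 < C1" "\<And>a. 0 \<le> a \<Longrightarrow> a < 1 \<Longrightarrow>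
      hardy_norm p (\<lambda>z. 1 / (1 - of_real a * z)) \<le> ennreal (C1 * (1 - a) powr (1 / p - 1))"
    using hardy_norm_kernel_le[OF p] by blast
  obtain C2 where C2: "0 < C2" "\<And>f A t. f holomorphic_on ball 0 1 \<Longrightarrow> 0 < A \<Longrightarrow>
      hardy_norm q f \<le> ennreal A \<Longrightarrow> 0 \<le> t \<Longrightarrow> t < 1 \<Longrightarrow>
      norm (f (of_real t)) \<le> C2 * A * (1 - t) powr (- (1 / q))"
    using hardy_growth[OF q] by blast
  from bdd obtain C0 where C0: "0 \<le> C0" "\<And>f. f \<in> hardy_space p \<Longrightarrow>
      hardy_norm q (derivative_hilbert \<mu> f) \<le> ennreal C0 * hardy_norm p f"
    unfolding hardy_bounded_operator_def by blast
  \<comment> \<open>The 8 is 2^3, from 1 - a^2 <= 2 (1 - a). Using \<open>C0 + 1\<close> instead of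
    \<open>C0\<close> makes the norm bound \<open>A\<close> below strictly positive, as the growth
    estimate asks.\<close>
  define C where "C = 8 * (C2 * (C0 + 1) * C1)"
  show ?thesis
    unfolding carleson_measure_def
  proof (intro exI conjI ballI)
    show "0 < C" using C0 C1 C2 by (simp add: C_def)
    fix a :: real assume "a \<in> {0..<1}"
    then have a: "0 \<le> a" "a < 1" by auto
    let ?f = "\<lambda>z :: complex. 1 / (1 - of_real a * z)"
    define A where "A = (C0 + 1) * (C1 * (1 - a) powr (1 / p - 1))"
    have A: "A > 0" using C0 C1 a by (simp add: A_def)
    have f: "?f \<in> hardy_space p"
      using kernel_holomorphic[of a] C1(2)[OF a] a
      by (auto simp: hardy_space_def intro: le_less_trans)
    have hol: "derivative_hilbert \<mu> ?f holomorphic_on ball 0 1"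
      using bdd f unfolding hardy_bounded_operator_def hardy_space_def by blast
    have "hardy_norm q (derivative_hilbert \<mu> ?f) \<le> ennreal C0 * hardy_norm p ?f"
      by (rule C0(2)[OF f])
    also have "\<dots> \<le> ennreal (C0 + 1) * ennreal (C1 * (1 - a) powr (1 / p - 1))"
      by (intro mult_mono C1(2) a ennreal_leI) auto
    also have "\<dots> = ennreal A"
      using C0 by (simp add: A_def ennreal_mult')
    finally have "norm (derivative_hilbert \<mu> ?f (of_real a)) \<le> C2 * A * (1 - a) powr (- (1 / q))"
      by (intro C2(2) hol A a)
    then have le: "measure \<mu> {a..<1} / (1 - a\<^sup>2) ^ 3 \<le> C2 * A * (1 - a) powr (- (1 / q))"
      using derivative_hilbert_kernel_ge[OF \<mu> a] by linarith
    have "0 < 1 - a\<^sup>2" using a by (simp add: power_less_one_iff)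
    then have "measure \<mu> {a..<1} \<le> C2 * A * (1 - a) powr (- (1 / q)) * (1 - a\<^sup>2) ^ 3"
      using le by (simp add: pos_divide_le_eq)
    also have "\<dots> \<le> C2 * A * (1 - a) powr (- (1 / q)) * (2 * (1 - a)) ^ 3"
    proof (intro mult_left_mono power_mono)
      have "1 - a\<^sup>2 = (1 + a) * (1 - a)" by (simp add: power2_eq_square algebra_simps)
      also have "\<dots> \<le> 2 * (1 - a)" using a by (intro mult_right_mono) auto
      finally show "1 - a\<^sup>2 \<le> 2 * (1 - a)" .
    qed (use \<open>0 < 1 - a\<^sup>2\<close> C2 A in auto)
    also have "\<dots> = C * ((1 - a) powr (1 / p - 1) * (1 - a) powr (- (1 / q)) * (1 - a) powr 3)"
    proof -
      define d where "d = 1 - a"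
      have "d > 0" using a by (simp add: d_def)
      then show ?thesis
        by (simp add: C_def A_def power_mult_distrib flip: d_def)
    qed
    also have "\<dots> = C * (1 - a) powr (1 / p + 2 - 1 / q)"
      by (simp add: algebra_simps flip: powr_add)
    finally show "emeasure \<mu> {a..<1} \<le> ennreal (C * (1 - a) powr (1 / p + 2 - 1 / q))"
      by (simp add: emeasure_eq_measure ennreal_leI)
  qed
qed

subsection \<open>Linearity and holomorphy\<close>

lemma fps_expansion_linear_combination:
  assumes f: "f holomorphic_on ball 0 1" and g: "g holomorphic_on ball 0 1"
  shows "fps_nth (fps_expansion (\<lambda>w. a * f w + b * g w) 0) k =
    a * fps_nth (fps_expansion f 0) k + b * fps_nth (fps_expansion g 0) k"
proof -
  have "f has_fps_expansion fps_expansion f 0" "g has_fps_expansion fps_expansion g 0"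
    using f g by (auto intro!: has_fps_expansion_fps_expansion[of "ball 0 1"])
  then have "(\<lambda>w. a * f w + b * g w) has_fps_expansion
      fps_const a * fps_expansion f 0 + fps_const b * fps_expansion g 0"
    by (intro fps_expansion_intros)
  then show ?thesis by (simp add: fps_expansion_eqI)
qed

lemma hardy_space_coefficients_bounded:
  assumes "1 \<le> p" "f \<in> hardy_space p"
  obtains M where "\<And>k. norm (fps_nth (fps_expansion f 0) k) \<le> M"
proof -
  have "hardy_norm p f \<le> ennreal (enn2real (hardy_norm p f))"
    using assms by (simp add: hardy_space_def)
  then show ?thesis
    using fps_expansion_nth_le_hardy_norm[of f p "enn2real (hardy_norm p f)"] assms that
    by (auto simp: hardy_space_def)
qed

text \<open>Linearity is read off the integral representation, which applies to the combination
  because its coefficients are bounded by |a| M + |b| N.\<close>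

lemma derivative_hilbert_linear:
  assumes p: "1 \<le> p"
    and \<mu>: "borel_measure_on_unit_interval \<mu>" "integrable \<mu> (\<lambda>t. 1 / (1 - t))"
    and f: "f \<in> hardy_space p" and g: "g \<in> hardy_space p" and z: "norm z < 1"
  shows "derivative_hilbert \<mu> (\<lambda>w. a * f w + b * g w) z =
    a * derivative_hilbert \<mu> f z + b * derivative_hilbert \<mu> g z"
proof -
  obtain M N where M: "\<And>k. norm (fps_nth (fps_expansion f 0) k) \<le> M"
    and N: "\<And>k. norm (fps_nth (fps_expansion g 0) k) \<le> N"
    using hardy_space_coefficients_bounded[OF p] f g by metis
  have hol: "f holomorphic_on ball 0 1" "g holomorphic_on ball 0 1"
    using f g by (auto simp: hardy_space_def)
  have "norm (fps_nth (fps_expansion (\<lambda>w. a * f w + b * g w) 0) k) \<le> norm a * M + norm b * N" for k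
    unfolding fps_expansion_linear_combination[OF hol]
    by (intro order_trans[OF norm_triangle_ineq] add_mono)
       (auto simp: norm_mult intro!: mult_left_mono M N)
  then have "derivative_hilbert \<mu> (\<lambda>w. a * f w + b * g w) z =
      (\<integral>t. (a * f (of_real t) + b * g (of_real t)) / (1 - of_real t * z)\<^sup>2 \<partial>\<mu>)"
    by (intro derivative_hilbert_eq_integral \<mu> z holomorphic_intros hol)
  also have "\<dots> = (\<integral>t. a * (f (of_real t) / (1 - of_real t * z)\<^sup>2) +
      b * (g (of_real t) / (1 - of_real t * z)\<^sup>2) \<partial>\<mu>)"
    by (simp add: add_divide_distrib)
  also have "\<dots> = a * (\<integral>t. f (of_real t) / (1 - of_real t * z)\<^sup>2 \<partial>\<mu>) +
      b * (\<integral>t. g (of_real t) / (1 - of_real t * z)\<^sup>2 \<partial>\<mu>)"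
    by (simp only: integral_mult_right_zero Bochner_Integration.integral_add
        integrable_mult_right[OF integrable_derivative_hilbert[OF \<mu> hol(1) M z]]
        integrable_mult_right[OF integrable_derivative_hilbert[OF \<mu> hol(2) N z]])
  finally show ?thesis
    by (simp only: derivative_hilbert_eq_integral[OF \<mu> hol(1) M z]
        derivative_hilbert_eq_integral[OF \<mu> hol(2) N z])
qed

lemma derivative_hilbert_holomorphic:
  assumes p: "1 \<le> p"
    and \<mu>: "borel_measure_on_unit_interval \<mu>" "integrable \<mu> (\<lambda>t. 1 / (1 - t))"
    and f: "f \<in> hardy_space p"
  shows "derivative_hilbert \<mu> f holomorphic_on ball 0 1"
proof -
  obtain M where M: "\<And>k. norm (fps_nth (fps_expansion f 0) k) \<le> M"
    using hardy_space_coefficients_bounded[OF p f] by metis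
  have hol: "f holomorphic_on ball 0 1" using f by (auto simp: hardy_space_def)
  show ?thesis
  proof (rule power_series_holomorphic)
    fix z :: complex assume "z \<in> ball 0 1"
    then have z: "norm z < 1" by simp
    show "(\<lambda>n. of_nat (n + 1) * (\<Sum>k. of_real (moment \<mu> (n + k)) * fps_nth (fps_expansion f 0) k) *
        (z - 0) ^ n) sums derivative_hilbert \<mu> f z"
      using derivative_hilbert_sums[OF \<mu> hol M z] derivative_hilbert_eq_integral[OF \<mu> hol M z]
      by simp
  qed
qed

subsection \<open>Sufficiency of the Carleson condition\<close>

text \<open>The exponent 2 is shared between two lower bounds of \<open>z\<close>: 2 - a goes to
  \<open>x\<close> and \<open>a\<close> to \<open>y\<close>. It is applied with x = 1 - t and y = |1
  - z| / 2 (for the disc variable), which separates the variables.\<close>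

lemma powr_split_kernel:
  fixes x y z a :: real
  assumes "0 < x" "0 < y" "x \<le> z" "y \<le> z" "0 \<le> a" "a \<le> 2"
  shows "1 / z\<^sup>2 \<le> x powr (- (2 - a)) * y powr (- a)"
proof -
  have z: "z > 0" using assms by linarith
  have "1 / z\<^sup>2 = z powr (- (2 - a)) * z powr (- a)"
    using z unfolding powr_add[symmetric] by (simp add: powr_minus_divide)
  also have "\<dots> \<le> x powr (- (2 - a)) * y powr (- a)"
    using assms z by (intro mult_mono powr_mono2') auto
  finally show ?thesis .
qed

lemma carleson_imp_derivative_hilbert_norm_le:
  assumes p: "1 < p" and q: "p \<le> q" and \<gamma>: "0 < \<gamma>"
    and \<mu>: "borel_measure_on_unit_interval \<mu>" "carleson_measure (1 / p + 2 - 1 / q + \<gamma>) \<mu>"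
  obtains C where "0 < C" "\<And>f A. f \<in> hardy_space p \<Longrightarrow> 0 < A \<Longrightarrow> hardy_norm p f \<le> ennreal A \<Longrightarrow>
    hardy_norm q (derivative_hilbert \<mu> f) \<le> ennreal (C * A)"
proof -
  note space = space_unit_interval[OF \<mu>(1)]
  \<comment> \<open>Any positive value gives \<alpha> q < 1; staying below \<gamma> keeps \<beta>
    under the Carleson exponent, and staying at most 1 / (2 q) keeps \<alpha> positive.\<close>
  define \<epsilon> where "\<epsilon> = min (\<gamma> / 2) (1 / (2 * q))"
  define \<alpha> where "\<alpha> = 1 / q - \<epsilon>"
  \<comment> \<open>The total singularity in \<open>t\<close>: 1/p from the growth of
    \<open>f\<close> and 2 - \<alpha> from the kernel.\<close>
  define \<beta> where "\<beta> = 1 / p + (2 - \<alpha>)"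
  have q1: "1 < q" using p q by simp
  have \<epsilon>: "0 < \<epsilon>" "\<epsilon> < \<gamma>" "\<epsilon> \<le> 1 / (2 * q)"
    using \<gamma> q1 by (auto simp: \<epsilon>_def)
  have "1 / (2 * q) < 1 / q" using q1 by (simp add: field_simps)
  then have \<alpha>0: "0 < \<alpha>" using \<epsilon> by (simp add: \<alpha>_def)
  have "1 / q < 1" using q1 by simp
  then have \<alpha>1: "\<alpha> < 1" using \<epsilon> unfolding \<alpha>_def by linarith
  have \<alpha>q: "\<alpha> * q < 1" using \<epsilon> q1 by (simp add: \<alpha>_def algebra_simps)
  have "1 / p > 0" using p by simp
  then have \<beta>: "1 \<le> \<beta>" "\<beta> < 1 / p + 2 - 1 / q + \<gamma>" using \<alpha>1 \<epsilon> unfolding \<beta>_def \<alpha>_def by linarith+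
  have int\<beta>: "integrable \<mu> (\<lambda>t. (1 - t) powr (- \<beta>))"
    using \<beta> by (intro integrable_carleson_powr[OF \<mu>]) auto
  \<comment> \<open>The exponent 1 is what the integral representation of the operator
    requires.\<close>
  have "integrable \<mu> (\<lambda>t. (1 - t) powr (- 1))"
    using \<beta> by (intro integrable_carleson_powr[OF \<mu>]) auto
  then have int1: "integrable \<mu> (\<lambda>t. 1 / (1 - t))"
    by (rule Bochner_Integration.integrable_cong[THEN iffD1, rotated 2])
       (auto simp: space powr_minus_divide)
  \<comment> \<open>The summand 1 keeps \<open>K\<close> positive even when the integral
    vanishes.\<close>
  define K where "K = 1 + (\<integral>t. (1 - t) powr (- \<beta>) \<partial>\<mu>)"
  have K: "K > 0"
    unfolding K_def by (intro add_pos_nonneg integral_nonneg_AE) auto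
  obtain C1 where C1: "0 < C1" "\<And>f A t. f holomorphic_on ball 0 1 \<Longrightarrow> 0 < A \<Longrightarrow>
      hardy_norm p f \<le> ennreal A \<Longrightarrow> 0 \<le> t \<Longrightarrow> t < 1 \<Longrightarrow>
      norm (f (of_real t)) \<le> C1 * A * (1 - t) powr (- (1 / p))"
    using hardy_growth[OF p] by blast
  \<comment> \<open>The subcritical kernel bound for the exponent \<alpha> q, uniform over all
    circles.\<close>
  define D where "D = 2 * 12 powr (\<alpha> * q) * (1 + 2 * pi) powr (1 - \<alpha> * q) / (1 - \<alpha> * q)"
  have "1 + 2 * pi > 0" by (simp add: add_pos_pos)
  then have D: "D > 0" using \<alpha>q by (simp add: D_def)
  \<comment> \<open>Arranged so that 2 pi (C A)^q equals the pointwise constant to the power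
    \<open>q\<close> times \<open>D\<close>.\<close>
  define C where "C = C1 * K * 2 powr \<alpha> * (D / (2 * pi)) powr (1 / q)"
  show ?thesis
  proof (rule that[of C])
    show C: "0 < C" using C1 K D by (simp add: C_def)
    fix f :: "complex \<Rightarrow> complex" and A :: real
    assume f: "f \<in> hardy_space p" and A: "0 < A" "hardy_norm p f \<le> ennreal A"
    have hol: "f holomorphic_on ball 0 1" using f by (auto simp: hardy_space_def)
    obtain M where M: "\<And>k. norm (fps_nth (fps_expansion f 0) k) \<le> M"
      using hardy_space_coefficients_bounded[OF _ f] p by auto
    have hol': "derivative_hilbert \<mu> f holomorphic_on ball 0 1"
      using p by (intro derivative_hilbert_holomorphic[OF _ \<mu>(1) int1 f]) auto
    have pointwise: "norm (derivative_hilbert \<mu> f z) \<le> C1 * A * K * 2 powr \<alpha> * norm (1 - z) powr (- \<alpha>)"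
      if z: "norm z < 1" for z
    proof -
      have z0: "0 < norm (1 - z)" using z by auto
      have "norm (derivative_hilbert \<mu> f z) \<le> (\<integral>t. norm (f (of_real t) / (1 - of_real t * z)\<^sup>2) \<partial>\<mu>)"
        unfolding derivative_hilbert_eq_integral[OF \<mu>(1) int1 hol M z]
        by (rule integral_norm_bound)
      also have "\<dots> \<le> (\<integral>t. C1 * A * (norm (1 - z) / 2) powr (- \<alpha>) * (1 - t) powr (- \<beta>) \<partial>\<mu>)"
      proof (rule integral_mono)
        show "integrable \<mu> (\<lambda>t. norm (f (of_real t) / (1 - of_real t * z)\<^sup>2))"
          by (intro integrable_norm integrable_derivative_hilbert[OF \<mu>(1) int1 hol M z])
        show "integrable \<mu> (\<lambda>t. C1 * A * (norm (1 - z) / 2) powr (- \<alpha>) * (1 - t) powr (- \<beta>))"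
          by (intro integrable_mult_right int\<beta>)
        fix t assume "t \<in> space \<mu>"
        then have t: "0 \<le> t" "t < 1" by (auto simp: space)
        have "norm (f (of_real t) / (1 - of_real t * z)\<^sup>2)
            = norm (f (of_real t)) * (1 / (norm (1 - of_real t * z))\<^sup>2)"
          by (simp add: norm_divide norm_power)
        also have "\<dots> \<le> (C1 * A * (1 - t) powr (- (1 / p))) *
            ((1 - t) powr (- (2 - \<alpha>)) * (norm (1 - z) / 2) powr (- \<alpha>))"
        proof (intro mult_mono C1(2) hol A t powr_split_kernel)
          show "1 - t \<le> norm (1 - of_real t * z)" "norm (1 - z) / 2 \<le> norm (1 - of_real t * z)"
            using norm_one_minus_le_twice[of z t] t z by auto
        qed (use t z0 \<alpha>0 \<alpha>1 C1(1) A(1) in auto)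
        also have "\<dots> = C1 * A * (norm (1 - z) / 2) powr (- \<alpha>) *
            ((1 - t) powr (- (1 / p)) * (1 - t) powr (- (2 - \<alpha>)))"
          by (simp only: mult_ac)
        also have "(1 - t) powr (- (1 / p)) * (1 - t) powr (- (2 - \<alpha>)) = (1 - t) powr (- \<beta>)"
          by (simp add: \<beta>_def flip: powr_add)
        finally show "norm (f (of_real t) / (1 - of_real t * z)\<^sup>2) \<le>
          C1 * A * (norm (1 - z) / 2) powr (- \<alpha>) * (1 - t) powr (- \<beta>)" .
      qed
      also have "\<dots> = C1 * A * (norm (1 - z) / 2) powr (- \<alpha>) * (K - 1)"
        by (simp add: K_def)
      also have "\<dots> \<le> C1 * A * (norm (1 - z) / 2) powr (- \<alpha>) * K"
        using C1 A by (intro mult_left_mono) auto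
      also have "(norm (1 - z) / 2) powr (- \<alpha>) = 2 powr \<alpha> * norm (1 - z) powr (- \<alpha>)"
        by (simp add: powr_divide powr_minus_divide)
      finally show ?thesis by (simp only: mult_ac)
    qed
    show "hardy_norm q (derivative_hilbert \<mu> f) \<le> ennreal (C * A)"
    proof (rule hardy_norm_leI)
      fix r :: real assume r: "0 < r" "r < 1"
      let ?B = "C1 * A * K * 2 powr \<alpha>"
      have B: "?B > 0" using C1 A K by simp
      have "integral {0..2 * pi} (\<lambda>x. norm (derivative_hilbert \<mu> f (of_real r * cis x)) powr q)
          \<le> integral {0..2 * pi} (\<lambda>x. ?B powr q * norm (1 - of_real r * cis x) powr (- (\<alpha> * q)))"
      proof (rule integral_le)
        show "(\<lambda>x. norm (derivative_hilbert \<mu> f (of_real r * cis x)) powr q) integrable_on {0..2 * pi}"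
          using q1 by (intro integrable_continuous_interval continuous_on_powr' continuous_intros
              continuous_on_circle[OF hol' r]) auto
        show "(\<lambda>x. ?B powr q * norm (1 - of_real r * cis x) powr (- (\<alpha> * q))) integrable_on {0..2 * pi}"
          using r by (intro integrable_continuous_interval continuous_on_mult_left circle_kernel_continuous) auto
        fix x
        have "norm (derivative_hilbert \<mu> f (of_real r * cis x)) powr q \<le>
            (?B * norm (1 - of_real r * cis x) powr (- \<alpha>)) powr q"
          using q1 r by (intro powr_mono2 pointwise) (auto simp: norm_mult)
        also have "\<dots> = ?B powr q * norm (1 - of_real r * cis x) powr (- (\<alpha> * q))"
          using B by (simp add: powr_mult powr_powr)
        finally show "norm (derivative_hilbert \<mu> f (of_real r * cis x)) powr q \<le> \<dots>" .
      qed
      also have "\<dots> = ?B powr q * integral {0..2 * pi} (\<lambda>x. norm (1 - of_real r * cis x) powr (- (\<alpha> * q)))"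
        by (rule integral_mult_right)
      also have "\<dots> \<le> ?B powr q * D"
        unfolding D_def using \<alpha>0 q1 \<alpha>q r
        by (intro mult_left_mono circle_kernel_integral_le_subcritical) auto
      also have "\<dots> = 2 * pi * (?B * (D / (2 * pi)) powr (1 / q)) powr q"
        using B D q1 by (simp add: powr_mult powr_powr)
      also have "?B * (D / (2 * pi)) powr (1 / q) = C * A"
        by (simp add: C_def mult_ac)
      finally show "integral {0..2 * pi} (\<lambda>x. norm (derivative_hilbert \<mu> f (of_real r * cis x)) powr q)
          \<le> 2 * pi * (C * A) powr q" .
    qed (use q1 C A in auto)
  qed
qed

lemma carleson_imp_hardy_bounded:
  assumes p: "1 < p" and q: "p \<le> q" and \<gamma>: "0 < \<gamma>"
    and \<mu>: "borel_measure_on_unit_interval \<mu>" "carleson_measure (1 / p + 2 - 1 / q + \<gamma>) \<mu>"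
  shows "hardy_bounded_operator p q (derivative_hilbert \<mu>)"
proof -
  have "1 / p > 0" "1 / q < 1" using p q by auto
  then have "1 < 1 / p + 2 - 1 / q + \<gamma>" using \<gamma> by linarith
  then have "integrable \<mu> (\<lambda>t. (1 - t) powr (- 1))"
    by (intro integrable_carleson_powr[OF \<mu>]) auto
  then have int1: "integrable \<mu> (\<lambda>t. 1 / (1 - t))"
    by (rule Bochner_Integration.integrable_cong[THEN iffD1, rotated 2])
       (auto simp: space_unit_interval[OF \<mu>(1)] powr_minus_divide)
  obtain C where C: "0 < C" "\<And>f A. f \<in> hardy_space p \<Longrightarrow> 0 < A \<Longrightarrow> hardy_norm p f \<le> ennreal A \<Longrightarrow>
      hardy_norm q (derivative_hilbert \<mu> f) \<le> ennreal (C * A)"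
    using carleson_imp_derivative_hilbert_norm_le[OF assms] by blast
  have bound: "hardy_norm q (derivative_hilbert \<mu> f) \<le> ennreal C * hardy_norm p f"
    if f: "f \<in> hardy_space p" for f
  \<comment> \<open>The previous estimate asks for a positive bound, whereas the norm of
    \<open>f\<close> may be 0. The bound N + e / C is positive and costs exactly \<open>e\<close>
    after multiplication by \<open>C\<close>.\<close>
  proof (rule ennreal_le_epsilon)
    fix e :: real assume e: "0 < e"
    obtain N where N: "0 \<le> N" "hardy_norm p f = ennreal N"
      using f by (cases "hardy_norm p f") (auto simp: hardy_space_def)
    have "hardy_norm q (derivative_hilbert \<mu> f) \<le> ennreal (C * (N + e / C))"
      using C N e by (intro C(2) f) (auto intro!: add_nonneg_pos ennreal_leI)
    also have "C * (N + e / C) = C * N + e" using C by (simp add: field_simps)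
    also have "ennreal (C * N + e) = ennreal C * hardy_norm p f + ennreal e"
      using C N e by (simp add: ennreal_mult)
    finally show "hardy_norm q (derivative_hilbert \<mu> f) \<le> ennreal C * hardy_norm p f + ennreal e" .
  qed
  show ?thesis
    unfolding hardy_bounded_operator_def
  proof (intro conjI ballI allI)
    fix f assume f: "f \<in> hardy_space p"
    have "ennreal C * hardy_norm p f < \<infinity>"
      using f by (auto simp: hardy_space_def ennreal_mult_less_top)
    then have "hardy_norm q (derivative_hilbert \<mu> f) < \<infinity>"
      using bound[OF f] by (rule le_less_trans[rotated])
    moreover have "derivative_hilbert \<mu> f holomorphic_on ball 0 1"
      using p by (intro derivative_hilbert_holomorphic[OF _ \<mu>(1) int1 f]) auto
    ultimately show "derivative_hilbert \<mu> f \<in> hardy_space q"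
      by (simp add: hardy_space_def)
  next
    fix f g a b and z :: complex
    assume "f \<in> hardy_space p" "g \<in> hardy_space p" "z \<in> ball 0 1"
    then show "derivative_hilbert \<mu> (\<lambda>w. a * f w + b * g w) z =
        a * derivative_hilbert \<mu> f z + b * derivative_hilbert \<mu> g z"
      using p by (intro derivative_hilbert_linear[OF _ \<mu>(1) int1, of p]) auto
  next
    show "\<exists>C\<ge>0. \<forall>f\<in>hardy_space p. hardy_norm q (derivative_hilbert \<mu> f) \<le> ennreal C * hardy_norm p f"
      using bound C(1) by (intro exI[of _ C]) auto
  qed
qed

theorem theorem4p2:
  fixes p q q' :: real and \<mu> :: "real measure"
  assumes "1 < p" and "p \<le> q" and "1 / q + 1 / q' = 1"
    and "borel_measure_on_unit_interval \<mu>"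
    and "carleson_measure 1 \<mu>"
  shows "(\<forall>\<gamma>>0. carleson_measure (1 / p + 1 / q' + 1 + \<gamma>) \<mu> \<longrightarrow>
            hardy_bounded_operator p q (derivative_hilbert \<mu>))
       \<and> (hardy_bounded_operator p q (derivative_hilbert \<mu>) \<longrightarrow>
            carleson_measure (1 / p + 1 / q' + 1) \<mu>)"
proof -
  \<comment> \<open>The conjugate exponent is eliminated through 1/q' = 1 - 1/q.\<close>
  have exponent: "1 / p + 1 / q' + 1 = 1 / p + 2 - 1 / q" using assms(3) by linarith
  \<comment> \<open>Finite mass, the Carleson condition at t = 0, makes the moments bounded in the
    necessity part.\<close>
  have "finite_measure \<mu>" using assms(4,5) by (rule carleson_measure_finite)
  then show ?thesis
    unfolding exponent using assms
    by (auto intro: carleson_imp_hardy_bounded hardy_bounded_imp_carleson)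
qed

end
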